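(* Let $X$ be a compact metric space and $T\colon X\to X$ continuous. Every royal measure for $T$ is ergodic.
   Context: Let $\rho$ be the metric of $X$. A $T$-periodic orbit is a finite set $\Gamma=\{x,T(x),\dots,T^{p-1}(x)\}$ with $T^p(x)=x$; the ergodic measure supported on $\Gamma$ is the uniform measure on $\Gamma$. A $T$-periodic orbit $\Gamma$ is a $(\gamma,\kappa)$-good approximation of a $T$-periodic orbit $\Lambda$ if there are a subset $\Delta\subset\Gamma$ with $|\Delta|/|\Gamma|\ge\kappa$ and a constant-to-one surjection $\psi\colon\Delta\to\Lambda$ (all fibres have the same cardinality) such that $\rho(T^j(y),T^j(\psi(y)))<\gamma$ for every $y\in\Delta$ and $0\le j<|\Lambda|$. A GIKN sequence is a sequence $(\Gamma_n)_{n\in\mathbb N}$ of $T$-periodic orbits with $|\Gamma_n|\nearrow\infty$ for which there are positive real sequences $(\gamma_n)$, $(\kappa_n)$ with: for each $n\ge1$, $\Gamma_{n+1}$ is a $(\gamma_n,\kappa_n)$-good approximation of $\Gamma_n$; $\sum_n\gamma_n<\infty$; $\prod_n\kappa_n>0$. A Borel probability measure is royal if it is the weak$^*$ limit of the ergodic measures $\mu_n$ supported on the orbits $\Gamma_n$ of a GIKN sequence. *)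

theory Defs
  imports "HOL-Probability.Probability"
begin

text \<open>The compact metric space is a type of class \<^class>\<open>metric_space\<close> whose \<^term>\<open>UNIV\<close> is
  compact; compactness and continuity of the map are hypotheses of the theorem only.\<close>

definition periodic_orbit :: "('a \<Rightarrow> 'a) \<Rightarrow> 'a set \<Rightarrow> bool" where
  "periodic_orbit T \<Gamma> \<longleftrightarrow> (\<exists>x p. p > 0 \<and> (T ^^ p) x = x \<and> \<Gamma> = (\<lambda>j. (T ^^ j) x) ` {..<p})"

definition orbit_measure :: "'a::topological_space set \<Rightarrow> 'a measure" where
  "orbit_measure \<Gamma> = distr (uniform_count_measure \<Gamma>) borel (\<lambda>x. x)"

definition good_approximation ::
  "('a::metric_space \<Rightarrow> 'a) \<Rightarrow> real \<Rightarrow> real \<Rightarrow> 'a set \<Rightarrow> 'a set \<Rightarrow> bool" where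
  "good_approximation T \<gamma> \<kappa> \<Gamma> \<Lambda> \<longleftrightarrow>
     (\<exists>\<Delta> \<psi>. \<Delta> \<subseteq> \<Gamma> \<and> real (card \<Delta>) / real (card \<Gamma>) \<ge> \<kappa> \<and>
        \<psi> ` \<Delta> = \<Lambda> \<and> (\<exists>k. \<forall>z\<in>\<Lambda>. card {y \<in> \<Delta>. \<psi> y = z} = k) \<and>
        (\<forall>y\<in>\<Delta>. \<forall>j<card \<Lambda>. dist ((T ^^ j) y) ((T ^^ j) (\<psi> y)) < \<gamma>))"

text \<open>Sequences are indexed from 0. The growth of the cardinalities to infinity is
  read as nondecreasing and unbounded, not necessarily strictly increasing. Convergence of the
  product to a positive limit is stated separately from its value, since \<^const>\<open>prodinf\<close> is a
  definite description.\<close>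

definition GIKN_sequence :: "('a::metric_space \<Rightarrow> 'a) \<Rightarrow> (nat \<Rightarrow> 'a set) \<Rightarrow> bool" where
  "GIKN_sequence T \<Gamma> \<longleftrightarrow>
     (\<forall>n. periodic_orbit T (\<Gamma> n)) \<and>
     incseq (\<lambda>n. card (\<Gamma> n)) \<and> filterlim (\<lambda>n. card (\<Gamma> n)) at_top sequentially \<and>
     (\<exists>\<gamma> \<kappa> :: nat \<Rightarrow> real.
        (\<forall>n. \<gamma> n > 0) \<and> (\<forall>n. \<kappa> n > 0) \<and>
        (\<forall>n. good_approximation T (\<gamma> n) (\<kappa> n) (\<Gamma> (Suc n)) (\<Gamma> n)) \<and>
        summable \<gamma> \<and> convergent_prod \<kappa> \<and> prodinf \<kappa> > 0)"

text \<open>Test functions are all continuous functions; on a compact space these are automatically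
  bounded.\<close>

definition weak_star_limit ::
  "(nat \<Rightarrow> 'a::topological_space measure) \<Rightarrow> 'a measure \<Rightarrow> bool" where
  "weak_star_limit M \<mu> \<longleftrightarrow>
     (\<forall>f :: 'a \<Rightarrow> real. continuous_on UNIV f \<longrightarrow>
        (\<lambda>n. integral\<^sup>L (M n) f) \<longlonglongrightarrow> integral\<^sup>L \<mu> f)"

definition royal :: "('a::metric_space \<Rightarrow> 'a) \<Rightarrow> 'a measure \<Rightarrow> bool" where
  "royal T \<mu> \<longleftrightarrow> prob_space \<mu> \<and> sets \<mu> = sets borel \<and>
     (\<exists>\<Gamma>. GIKN_sequence T \<Gamma> \<and> weak_star_limit (\<lambda>n. orbit_measure (\<Gamma> n)) \<mu>)"

definition ergodic :: "('a::topological_space \<Rightarrow> 'a) \<Rightarrow> 'a measure \<Rightarrow> bool" where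
  "ergodic T \<mu> \<longleftrightarrow> prob_space \<mu> \<and> sets \<mu> = sets borel \<and>
     T \<in> borel_measurable borel \<and> distr \<mu> borel T = \<mu> \<and>
     (\<forall>A\<in>sets borel. T -` A = A \<longrightarrow> measure \<mu> A = 0 \<or> measure \<mu> A = 1)"

end

theory Submission
  imports Defs
begin

text \<open>Pulling subsets back through the good approximations shows that, for \<open>m \<ge> n\<close>, a proportion
  at least \<open>\<Prod>k=n..<m. \<kappa> k\<close> of \<open>\<Gamma> m\<close> shadows \<open>\<Gamma> n\<close> within \<open>\<Sum>k=n..<m. \<gamma> k\<close> for one full period of
  \<open>\<Gamma> n\<close>. Over a full period the Birkhoff average of a continuous \<open>f\<close> along \<open>\<Gamma> n\<close> equals its mean over \<open>\<Gamma> n\<close>.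
  Letting \<open>m\<close> tend to infinity, the Birkhoff averages of length \<open>card (\<Gamma> n)\<close> converge in \<open>L\<^sup>1(\<mu>)\<close> to the
  constant \<open>\<integral>f d\<mu>\<close>. Integrating over an invariant set \<open>A\<close> gives \<open>\<integral>\<^sub>A f d\<mu> = \<mu>(A) \<integral>f d\<mu>\<close> for all
  continuous \<open>f\<close>, so \<open>\<mu>(A \<inter> B) = \<mu>(A) \<mu>(B)\<close> for all Borel \<open>B\<close>; take \<open>B = A\<close>.\<close>

section \<open>Periodic orbits and their uniform measures\<close>

text \<open>The \<open>p\<close> in \<open>periodic_orbit\<close> need not be minimal, so its
  enumeration may run through the orbit several times. The least period at the chosen base point
  gives an injective enumeration, whose length is therefore the cardinality.\<close>

lemma periodic_orbit_bij_betw: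
  assumes "periodic_orbit T \<Gamma>" "z \<in> \<Gamma>"
  shows "bij_betw (\<lambda>j. (T ^^ j) z) {..<card \<Gamma>} \<Gamma>"
proof -
  obtain x p where p: "p > 0" "(T ^^ p) x = x" and \<Gamma>: "\<Gamma> = (\<lambda>j. (T ^^ j) x) ` {..<p}"
    using assms(1) unfolding periodic_orbit_def by blast
  obtain i where i: "i < p" "z = (T ^^ i) x"
    using assms(2) \<Gamma> by auto
  have zp: "(T ^^ p) z = z"
    by (metis add.commute funpow_add i(2) o_apply p(2))
  define q where "q = (LEAST q. q > 0 \<and> (T ^^ q) z = z)"
  have q: "q > 0" "(T ^^ q) z = z"
    using LeastI[of "\<lambda>q. q > 0 \<and> (T ^^ q) z = z" p] p(1) zp unfolding q_def by auto
  have q_min: "q \<le> k" if "k > 0" "(T ^^ k) z = z" for k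
    unfolding q_def by (rule Least_le) (use that in auto)
  have "\<Gamma> = range (\<lambda>j. (T ^^ j) x)"
  proof -
    have "(T ^^ j) x \<in> \<Gamma>" for j
      using funpow_mod_eq[OF p(2), of j] p(1) \<Gamma> by (metis imageI lessThan_iff mod_less_divisor)
    then show ?thesis using \<Gamma> by auto
  qed
  also have "\<dots> = range (\<lambda>j. (T ^^ j) z)"
  proof -
    \<comment> \<open>Another \<open>p - i\<close> steps from \<open>z\<close> close the cycle at
      \<open>x\<close>, so each of \<open>x\<close> and \<open>z\<close> lies on the forward orbit
      of the other.\<close>
    have "(T ^^ (p - i)) z = x"
      using i p by (metis add.commute funpow_add le_add_diff_inverse less_imp_le o_apply)
    then have "(T ^^ j) x = (T ^^ (j + (p - i))) z" for j
      by (simp add: funpow_add)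
    moreover have "(T ^^ j) z = (T ^^ (j + i)) x" for j
      by (simp add: funpow_add i)
    ultimately show ?thesis by (metis (mono_tags, lifting) image_subset_iff rangeI subset_antisym)
  qed
  also have "\<dots> = (\<lambda>j. (T ^^ j) z) ` {..<q}"
  proof -
    have "(T ^^ j) z \<in> (\<lambda>j. (T ^^ j) z) ` {..<q}" for j
      using funpow_mod_eq[OF q(2), of j] q(1) by (metis imageI lessThan_iff mod_less_divisor)
    then show ?thesis by auto
  qed
  finally have \<Gamma>q: "\<Gamma> = (\<lambda>j. (T ^^ j) z) ` {..<q}" .
  have neq: "(T ^^ a) z \<noteq> (T ^^ b) z" if "a < b" "b < q" for a b
  proof
    assume eq: "(T ^^ a) z = (T ^^ b) z"
    \<comment> \<open>Applying \<open>q - b\<close> further iterates to both sides of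
      \<open>eq\<close> makes \<open>z\<close> return after \<open>q - b + a\<close> steps, which is
      positive and less than \<open>q\<close>.\<close>
    have "(T ^^ (q - b + a)) z = (T ^^ (q - b + b)) z"
      unfolding funpow_add o_apply eq ..
    then show False
      using q_min[of "q - b + a"] q(2) that by simp
  qed
  have "inj_on (\<lambda>j. (T ^^ j) z) {..<q}"
    by (rule linorder_inj_onI) (use neq in auto)
  then show ?thesis
    using \<Gamma>q by (simp add: bij_betw_def card_image)
qed

lemma periodic_orbit_finite_nonempty:
  assumes "periodic_orbit T \<Gamma>"
  shows "finite \<Gamma>" "\<Gamma> \<noteq> {}"
  using assms unfolding periodic_orbit_def by auto

lemma periodic_orbit_sum:
  assumes "periodic_orbit T \<Gamma>" "z \<in> \<Gamma>"
  shows "(\<Sum>j<card \<Gamma>. f ((T ^^ j) z)) = sum f \<Gamma>"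
  using sum.reindex_bij_betw[OF periodic_orbit_bij_betw[OF assms]] .

text \<open>Both sides are sums over one full period, started at \<open>x\<close> and at
  \<open>T x\<close>. This is the invariance of the orbit measure in summed form.\<close>

lemma periodic_orbit_sum_shift:
  assumes "periodic_orbit T \<Gamma>"
  shows "(\<Sum>y\<in>\<Gamma>. f (T y)) = sum f \<Gamma>"
proof -
  obtain x p where p: "p > 0" "(T ^^ p) x = x" and \<Gamma>: "\<Gamma> = (\<lambda>j. (T ^^ j) x) ` {..<p}"
    using assms unfolding periodic_orbit_def by blast
  have "x \<in> \<Gamma>"
    using p \<Gamma> by (auto intro: image_eqI[of _ _ 0])
  moreover have "T x \<in> \<Gamma>"
    \<comment> \<open>The exponent 1 is reduced modulo \<open>p\<close> because a fixed point may
      have \<open>p = 1\<close>.\<close>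
    using funpow_mod_eq[OF p(2), of 1] p(1) \<Gamma>
    by (metis One_nat_def comp_id funpow.simps funpow_0 imageI lessThan_iff mod_less_divisor)
  ultimately show ?thesis
    using periodic_orbit_sum[OF assms, of x "\<lambda>y. f (T y)"] periodic_orbit_sum[OF assms, of "T x" f]
    by (simp add: funpow_swap1)
qed

lemma integral_orbit_measure:
  fixes f :: "'a::topological_space \<Rightarrow> real"
  assumes "finite \<Gamma>" "\<Gamma> \<noteq> {}" "f \<in> borel_measurable borel"
  shows "integral\<^sup>L (orbit_measure \<Gamma>) f = sum f \<Gamma> / card \<Gamma>"
proof -
  have "(\<lambda>x. x) \<in> uniform_count_measure \<Gamma> \<rightarrow>\<^sub>M borel"
    by (auto simp: measurable_def sets_uniform_count_measure space_uniform_count_measure)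
  then show ?thesis
    using assms unfolding orbit_measure_def
    by (simp add: integral_distr integral_uniform_count_measure)
qed

section \<open>Composing good approximations\<close>

text \<open>Since the fibres of \<open>\<psi>\<close> have equal size, the preimage of
  \<open>D\<close> fills the same proportion of \<open>\<Delta>\<close> as \<open>D\<close> does of
  \<open>\<Lambda>\<close>, and \<open>\<Delta>\<close> fills at least \<open>\<kappa>\<close> of
  \<open>\<Gamma>\<close>.\<close>

lemma good_approximation_preimage:
  fixes T :: "'a::metric_space \<Rightarrow> 'a"
  assumes "good_approximation T \<gamma> \<kappa> \<Gamma> \<Lambda>" "finite \<Gamma>" "finite \<Lambda>" "\<Lambda> \<noteq> {}" "D \<subseteq> \<Lambda>"
  obtains D' where "D' \<subseteq> \<Gamma>" "\<kappa> * (card D / card \<Lambda>) \<le> card D' / card \<Gamma>"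
    "\<And>y. y \<in> D' \<Longrightarrow> \<exists>z\<in>D. \<forall>j<card \<Lambda>. dist ((T ^^ j) y) ((T ^^ j) z) < \<gamma>"
proof -
  obtain \<Delta> \<psi> k where \<Delta>: "\<Delta> \<subseteq> \<Gamma>" "\<kappa> \<le> real (card \<Delta>) / real (card \<Gamma>)" "\<psi> ` \<Delta> = \<Lambda>"
    and k: "\<forall>z\<in>\<Lambda>. card {y \<in> \<Delta>. \<psi> y = z} = k"
    and close: "\<forall>y\<in>\<Delta>. \<forall>j<card \<Lambda>. dist ((T ^^ j) y) ((T ^^ j) (\<psi> y)) < \<gamma>"
    using assms(1) unfolding good_approximation_def by blast
  have card: "card {y \<in> \<Delta>. \<psi> y \<in> E} = card E * k" if "E \<subseteq> \<Lambda>" for E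
  proof -
    have fin: "finite \<Delta>" "finite E"
      using \<Delta>(1) assms that by (auto intro: finite_subset)
    have "{y \<in> \<Delta>. \<psi> y \<in> E} = (\<Union>z\<in>E. {y \<in> \<Delta>. \<psi> y = z})" by auto
    also have "card \<dots> = (\<Sum>z\<in>E. card {y \<in> \<Delta>. \<psi> y = z})"
      using fin by (subst card_UN_disjoint) auto
    also have "\<dots> = card E * k"
      using k that by (simp add: subset_iff)
    finally show ?thesis .
  qed
  have "{y \<in> \<Delta>. \<psi> y \<in> \<Lambda>} = \<Delta>" using \<Delta>(3) by auto
  then have cardD: "card \<Delta> = card \<Lambda> * k" using card[of \<Lambda>] by simp
  define D' where "D' = {y \<in> \<Delta>. \<psi> y \<in> D}"
  show ?thesis
  proof (rule that[of D'])
    show "D' \<subseteq> \<Gamma>" using \<Delta>(1) D'_def by auto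
    have "\<kappa> * (card D / card \<Lambda>) \<le> (card \<Delta> / card \<Gamma>) * (card D / card \<Lambda>)"
      by (intro mult_right_mono \<Delta>(2)) auto
    also have "\<dots> = card D' / card \<Gamma>"
      using assms(3,4) card[OF assms(5)] cardD by (simp add: D'_def)
    finally show "\<kappa> * (card D / card \<Lambda>) \<le> card D' / card \<Gamma>" .
  qed (use close D'_def in auto)
qed

text \<open>Induction on \<open>m\<close>: one more pullback multiplies the proportion by
  \<open>\<kappa> m\<close> and, by the triangle inequality, adds \<open>\<gamma> m\<close> to the
  shadowing distance.\<close>

lemma good_approximation_chain:
  fixes T :: "'a::metric_space \<Rightarrow> 'a"
  assumes approx: "\<And>n. good_approximation T (\<gamma> n) (\<kappa> n) (\<Gamma> (Suc n)) (\<Gamma> n)"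
    and fin: "\<And>n. finite (\<Gamma> n)" "\<And>n. \<Gamma> n \<noteq> {}"
    and inc: "incseq (\<lambda>n. card (\<Gamma> n))" and pos: "\<And>n. \<kappa> n > 0"
    and "n \<le> m"
  shows "\<exists>D\<subseteq>\<Gamma> m. (\<Prod>k=n..<m. \<kappa> k) \<le> card D / card (\<Gamma> m) \<and>
    (\<forall>y\<in>D. \<exists>z\<in>\<Gamma> n. \<forall>j<card (\<Gamma> n). dist ((T ^^ j) y) ((T ^^ j) z) \<le> (\<Sum>k=n..<m. \<gamma> k))"
  using \<open>n \<le> m\<close>
proof (induction m rule: dec_induct)
  case base
  show ?case
    \<comment> \<open>Each point shadows itself; the empty sum is 0, which is why the distance bound
      is not strict.\<close>
    by (rule exI[of _ "\<Gamma> n"]) (use fin[of n] in \<open>auto intro!: bexI\<close>)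
next
  case (step m)
  then obtain D where D: "D \<subseteq> \<Gamma> m" "(\<Prod>k=n..<m. \<kappa> k) \<le> card D / card (\<Gamma> m)"
    and close: "\<And>y. y \<in> D \<Longrightarrow>
      \<exists>z\<in>\<Gamma> n. \<forall>j<card (\<Gamma> n). dist ((T ^^ j) y) ((T ^^ j) z) \<le> (\<Sum>k=n..<m. \<gamma> k)"
    by auto
  obtain D' where D': "D' \<subseteq> \<Gamma> (Suc m)" "\<kappa> m * (card D / card (\<Gamma> m)) \<le> card D' / card (\<Gamma> (Suc m))"
    and close': "\<And>y. y \<in> D' \<Longrightarrow> \<exists>z\<in>D. \<forall>j<card (\<Gamma> m). dist ((T ^^ j) y) ((T ^^ j) z) < \<gamma> m"
    by (rule good_approximation_preimage[OF approx fin(1) fin D(1)]) blast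
  have "(\<Prod>k=n..<Suc m. \<kappa> k) = \<kappa> m * (\<Prod>k=n..<m. \<kappa> k)"
    using step by simp
  also have "\<dots> \<le> \<kappa> m * (card D / card (\<Gamma> m))"
    using D(2) pos[of m] by (intro mult_left_mono) auto
  also note D'(2)
  finally have "(\<Prod>k=n..<Suc m. \<kappa> k) \<le> card D' / card (\<Gamma> (Suc m))" .
  moreover have "\<exists>z\<in>\<Gamma> n. \<forall>j<card (\<Gamma> n). dist ((T ^^ j) y) ((T ^^ j) z) \<le> (\<Sum>k=n..<Suc m. \<gamma> k)"
    if y: "y \<in> D'" for y
  proof -
    obtain w where w: "w \<in> D" "\<And>j. j < card (\<Gamma> m) \<Longrightarrow> dist ((T ^^ j) y) ((T ^^ j) w) < \<gamma> m"
      using close'[OF y] by auto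
    obtain z where z: "z \<in> \<Gamma> n"
      "\<And>j. j < card (\<Gamma> n) \<Longrightarrow> dist ((T ^^ j) w) ((T ^^ j) z) \<le> (\<Sum>k=n..<m. \<gamma> k)"
      using close[OF w(1)] by auto
    have "dist ((T ^^ j) y) ((T ^^ j) z) \<le> (\<Sum>k=n..<Suc m. \<gamma> k)" if j: "j < card (\<Gamma> n)" for j
    proof -
      \<comment> \<open>The new approximation controls \<open>card (\<Gamma> m)\<close> iterates;
        monotone cardinalities make this window contain the one of
        \<open>\<Gamma> n\<close>.\<close>
      have "j < card (\<Gamma> m)"
        using j incseqD[OF inc step(1)] by simp
      then show ?thesis
        using w(2)[of j] z(2)[OF j] step(1) dist_triangle[of "(T ^^ j) y" "(T ^^ j) z" "(T ^^ j) w"]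
        by simp
    qed
    then show ?thesis using z(1) by blast
  qed
  ultimately show ?case using D'(1) by blast
qed

section \<open>Tails of the product and of the series\<close>

text \<open>With factors at most 1 the partial products \<open>P\<close> decrease to the limit, so a
  block \<open>P m / P n\<close> is at least \<open>prodinf \<kappa> / P n\<close>. This tends to 1
  because the limit is positive.\<close>

lemma convergent_prod_tail_ge:
  fixes \<kappa> :: "nat \<Rightarrow> real"
  assumes pos: "\<And>n. 0 < \<kappa> n" and le1: "\<And>n. \<kappa> n \<le> 1"
    and conv: "convergent_prod \<kappa>" "prodinf \<kappa> > 0" and "\<epsilon> > 0"
  shows "\<forall>\<^sub>F n in sequentially. \<forall>m\<ge>n. 1 - \<epsilon> \<le> (\<Prod>k=n..<m. \<kappa> k)"
proof -
  define P where "P n = (\<Prod>k<n. \<kappa> k)" for n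
  have P: "P \<longlonglongrightarrow> prodinf \<kappa>"
    unfolding P_def using convergent_prod_LIMSEQ[OF conv(1)]
    \<comment> \<open>The known limit concerns products over \<open>{..n}\<close>, that is
      \<open>P (Suc n)\<close>; the index is shifted back.\<close>
    by (subst (asm) lessThan_Suc_atMost[symmetric]) (rule LIMSEQ_imp_Suc)
  have Ppos: "P n > 0" for n
    unfolding P_def using pos by (simp add: prod_pos)
  have "P (Suc n) \<le> P n" for n
    using mult_left_le[OF le1 less_imp_le[OF Ppos]] by (simp add: P_def)
  then have "decseq P"
    by (rule decseq_SucI)
  then have ge: "prodinf \<kappa> \<le> P m" for m
    using P by (rule decseq_ge)
  have "(\<lambda>n. prodinf \<kappa> / P n) \<longlonglongrightarrow> prodinf \<kappa> / prodinf \<kappa>"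
    using conv(2) by (intro tendsto_intros P) auto
  then have "(\<lambda>n. prodinf \<kappa> / P n) \<longlonglongrightarrow> 1" using conv(2) by simp
  then have "\<forall>\<^sub>F n in sequentially. 1 - \<epsilon> < prodinf \<kappa> / P n"
    by (rule order_tendstoD) (use \<open>\<epsilon> > 0\<close> in simp)
  then show ?thesis
  proof eventually_elim
    case (elim n)
    show ?case
    proof (intro allI impI)
      fix m assume "n \<le> m"
      then have "P m = P n * (\<Prod>k=n..<m. \<kappa> k)"
        unfolding P_def by (metis atLeast0LessThan prod.atLeastLessThan_concat zero_le)
      then have "(\<Prod>k=n..<m. \<kappa> k) = P m / P n" using Ppos[of n] by simp
      also have "\<dots> \<ge> prodinf \<kappa> / P n"
        using ge[of m] Ppos[of n] by (intro divide_right_mono) auto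
      finally show "1 - \<epsilon> \<le> (\<Prod>k=n..<m. \<kappa> k)" using elim by simp
    qed
  qed
qed

lemma summable_tail_less:
  fixes \<gamma> :: "nat \<Rightarrow> real"
  assumes "summable \<gamma>" "\<delta> > 0"
  shows "\<forall>\<^sub>F n in sequentially. \<forall>m\<ge>n. (\<Sum>k=n..<m. \<gamma> k) < \<delta>"
proof -
  obtain N where "\<And>m n. m \<ge> N \<Longrightarrow> norm (sum \<gamma> {m..<n}) < \<delta>"
    using assms unfolding summable_Cauchy by meson
  then show ?thesis
    unfolding eventually_sequentially by (metis abs_ge_self order.strict_trans1 real_norm_def)
qed

section \<open>Continuous functions determine a finite Borel measure\<close>

text \<open>Closed sets form an intersection-stable generator. The indicator of a nonempty closed
  set is a pointwise limit of bounded continuous functions of the distance to it, so dominated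
  convergence recovers its measure.\<close>

lemma finite_measure_eqI_continuous:
  fixes M N :: "'a::metric_space measure"
  assumes "finite_measure M" "finite_measure N" and sets: "sets M = sets borel" "sets N = sets borel"
    and eq: "\<And>f :: 'a \<Rightarrow> real. continuous_on UNIV f \<Longrightarrow> bounded (range f) \<Longrightarrow>
      integral\<^sup>L M f = integral\<^sup>L N f"
  shows "M = N"
proof -
  interpret M: finite_measure M by fact
  interpret N: finite_measure N by fact
  have closed_eq: "measure M C = measure N C" if C: "closed C" for C
  \<comment> \<open>\<open>infdist x {}\<close> is 0 by convention, so for empty \<open>C\<close>
    the functions below would be constantly 1.\<close>
  proof (cases "C = {}")
    case False
    define f :: "nat \<Rightarrow> 'a \<Rightarrow> real" where "f n x = max 0 (1 - real n * infdist x C)" for n x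
    have cont: "continuous_on UNIV (f n)" for n
      unfolding f_def by (intro continuous_intros)
    have bound: "norm (f n x) \<le> 1" for n x
      unfolding f_def using infdist_nonneg[of x C] by (simp add: max_def)
    have lim: "(\<lambda>n. f n x) \<longlonglongrightarrow> indicator C x" for x
    proof (cases "x \<in> C")
      case False
      then have pos: "infdist x C > 0"
        using C \<open>C \<noteq> {}\<close> infdist_nonneg[of x C] in_closed_iff_infdist_zero[OF C, of x] by simp
      obtain N :: nat where N: "1 < real N * infdist x C"
        using ex_less_of_nat_mult[OF pos] by blast
      have "f n x = 0" if "n \<ge> N" for n
      proof -
        have "real N * infdist x C \<le> real n * infdist x C"
          using that pos by (intro mult_right_mono) auto
        then show ?thesis using N by (simp add: f_def)
      qed
      then have "(\<lambda>n. f n x) \<longlonglongrightarrow> 0"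
        by (intro tendsto_eventually) (auto simp: eventually_sequentially)
      then show ?thesis using False by simp
    qed (simp add: f_def)
    have conv: "(\<lambda>n. integral\<^sup>L K (f n)) \<longlonglongrightarrow> measure K C"
      if K: "finite_measure K" "sets K = sets borel" for K :: "'a measure"
    proof -
      interpret finite_measure K by fact
      have Cs: "C \<in> sets K" using C K by simp
      have "(\<lambda>n. integral\<^sup>L K (f n)) \<longlonglongrightarrow> integral\<^sup>L K (indicator C)"
        by (rule integral_dominated_convergence[where w = "\<lambda>_. 1"])
          (use lim bound K Cs cont in \<open>auto simp: measurable_cong_sets[OF K(2) refl] borel_measurable_continuous_onI\<close>)
      then show ?thesis using Cs sets.sets_into_space[OF Cs] by (simp add: Int_absorb2)
    qed
    have "integral\<^sup>L M (f n) = integral\<^sup>L N (f n)" for n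
      using bound by (intro eq cont boundedI[of _ 1]) auto
    then show ?thesis
      using conv[OF assms(1) sets(1)] conv[OF assms(2) sets(2)] by (simp add: LIMSEQ_unique)
  qed simp
  show ?thesis
  proof (rule measure_eqI_generator_eq[where E = "Collect closed" and \<Omega> = UNIV and A = "\<lambda>_. UNIV"])
    show "Int_stable (Collect closed :: 'a set set)"
      by (auto simp: Int_stable_def)
    show "emeasure M X = emeasure N X" if "X \<in> Collect closed" for X
      using closed_eq[of X] that by (simp add: M.emeasure_eq_measure N.emeasure_eq_measure)
  qed (use sets in \<open>auto simp: borel_eq_closed\<close>)
qed

section \<open>L1 convergence of the Birkhoff averages\<close>

text \<open>The sum is split into \<open>D\<close>, where \<open>g\<close> is small, and its
  complement, which has proportion at most \<open>\<delta>\<close> and carries only the crude bound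
  \<open>C\<close>.\<close>

lemma integral_orbit_measure_le:
  fixes g :: "'a::topological_space \<Rightarrow> real"
  assumes "finite \<Gamma>" "\<Gamma> \<noteq> {}" "g \<in> borel_measurable borel"
    and "D \<subseteq> \<Gamma>" "1 - \<delta> \<le> card D / card \<Gamma>"
    and D: "\<And>y. y \<in> D \<Longrightarrow> g y \<le> \<epsilon>" and C: "\<And>y. y \<in> \<Gamma> \<Longrightarrow> g y \<le> C" and "0 \<le> \<epsilon>" "0 \<le> C"
  shows "integral\<^sup>L (orbit_measure \<Gamma>) g \<le> \<epsilon> + C * \<delta>"
proof -
  have pos: "card \<Gamma> > 0" using assms(1,2) by (simp add: card_gt_0_iff)
  have finD: "finite D" using assms(1,4) finite_subset by auto
  have le: "card D \<le> card \<Gamma>" using assms(1,4) by (rule card_mono)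
  have "sum g \<Gamma> = sum g D + sum g (\<Gamma> - D)"
    using sum.subset_diff[OF assms(4,1), of g] by simp
  also have "\<dots> \<le> card D * \<epsilon> + card (\<Gamma> - D) * C"
    using D C by (intro add_mono sum_bounded_above) auto
  also have "\<dots> \<le> card \<Gamma> * \<epsilon> + (\<delta> * card \<Gamma>) * C"
  proof (intro add_mono mult_right_mono)
    have "(1 - \<delta>) * card \<Gamma> \<le> card D"
      using assms(5) pos by (simp add: pos_le_divide_eq)
    then show "real (card (\<Gamma> - D)) \<le> \<delta> * card \<Gamma>"
      using finD assms(4) le by (simp add: card_Diff_subset of_nat_diff algebra_simps)
  qed (use assms le in auto)
  finally have "sum g \<Gamma> \<le> (\<epsilon> + C * \<delta>) * card \<Gamma>"
    by (simp add: algebra_simps)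
  then show ?thesis
    using pos by (simp add: integral_orbit_measure[OF assms(1-3)] pos_divide_le_eq)
qed

lemma continuous_on_funpow:
  fixes T :: "'a::topological_space \<Rightarrow> 'a"
  assumes "continuous_on UNIV T"
  shows "continuous_on UNIV (T ^^ j)"
proof (induction j)
  case (Suc j)
  show ?case
    unfolding funpow.simps by (intro continuous_on_compose Suc continuous_on_subset[OF assms]) simp
qed (simp add: id_def continuous_on_id)

text \<open>For fixed large \<open>n\<close> the deviation is one continuous function with mean at
  most \<open>\<epsilon>\<close> over every later orbit, so the weak-star limit inherits the bound.
  The comparison constant is the mean over \<open>\<Gamma> n\<close>, which the full-period averages
  hit exactly.\<close>

lemma GIKN_birkhoff_average_L1:
  fixes T :: "'a::metric_space \<Rightarrow> 'a" and f :: "'a \<Rightarrow> real"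
  assumes compact: "compact (UNIV :: 'a set)" and T: "continuous_on UNIV T"
    and GIKN: "GIKN_sequence T \<Gamma>" and lim: "weak_star_limit (\<lambda>n. orbit_measure (\<Gamma> n)) \<mu>"
    and f: "continuous_on UNIV f" and "\<epsilon> > 0"
  shows "\<forall>\<^sub>F n in sequentially. (\<integral>x. \<bar>(\<Sum>j<card (\<Gamma> n). f ((T ^^ j) x)) / card (\<Gamma> n)
    - integral\<^sup>L (orbit_measure (\<Gamma> n)) f\<bar> \<partial>\<mu>) \<le> \<epsilon>"
proof -
  obtain \<gamma> \<kappa> :: "nat \<Rightarrow> real" where \<gamma>: "summable \<gamma>"
    and \<kappa>: "\<And>n. \<kappa> n > 0" "convergent_prod \<kappa>" "prodinf \<kappa> > 0"
    and approx: "\<And>n. good_approximation T (\<gamma> n) (\<kappa> n) (\<Gamma> (Suc n)) (\<Gamma> n)"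
    and orbit: "\<And>n. periodic_orbit T (\<Gamma> n)" and inc: "incseq (\<lambda>n. card (\<Gamma> n))"
    using GIKN unfolding GIKN_sequence_def by blast
  note fin = periodic_orbit_finite_nonempty[OF orbit]
  have pos: "card (\<Gamma> n) > 0" for n
    using fin[of n] by (simp add: card_gt_0_iff)
  \<comment> \<open>Forced by the definition: \<open>\<kappa> n\<close> is a lower bound for the
    proportion of a subset.\<close>
  have \<kappa>1: "\<kappa> n \<le> 1" for n
  proof -
    obtain \<Delta> where "\<Delta> \<subseteq> \<Gamma> (Suc n)" "\<kappa> n \<le> card \<Delta> / card (\<Gamma> (Suc n))"
      using approx[of n] unfolding good_approximation_def by blast
    moreover from this have "card \<Delta> \<le> card (\<Gamma> (Suc n))"
      using fin(1) card_mono by blast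
    ultimately show ?thesis
      using pos[of "Suc n"] by (smt (verit) divide_le_eq_1 of_nat_0_less_iff of_nat_le_iff)
  qed
  have "bounded (range f)"
    by (rule compact_imp_bounded[OF compact_continuous_image[OF f compact]])
  then obtain B where B: "B > 0" "\<And>x. \<bar>f x\<bar> \<le> B"
    unfolding bounded_pos by auto
  have fm: "f \<in> borel_measurable borel"
    using f by (rule borel_measurable_continuous_onI)
  \<comment> \<open>The deviation never exceeds \<open>2 * B\<close>, so an exceptional proportion
    \<open>\<delta>\<close> contributes at most \<open>\<epsilon> / 2\<close>.\<close>
  define \<delta> where "\<delta> = \<epsilon> / (2 * (2 * B))"
  define c where "c n = integral\<^sup>L (orbit_measure (\<Gamma> n)) f" for n
  define g where "g n x = \<bar>(\<Sum>j<card (\<Gamma> n). f ((T ^^ j) x)) / card (\<Gamma> n) - c n\<bar>" for n x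
  have c: "c n = sum f (\<Gamma> n) / card (\<Gamma> n)" for n
    unfolding c_def by (rule integral_orbit_measure[OF fin fm])
  have gcont: "continuous_on UNIV (g n)" for n
    unfolding g_def
    by (intro continuous_intros continuous_on_compose2[OF f] continuous_on_funpow T) (use pos[of n] in auto)
  have gm: "g n \<in> borel_measurable borel" for n
    using gcont by (rule borel_measurable_continuous_onI)
  have avg: "\<bar>sum h A / card A\<bar> \<le> b"
    if "finite A" "A \<noteq> {}" "\<And>x. x \<in> A \<Longrightarrow> \<bar>h x\<bar> \<le> b" for h :: "'b \<Rightarrow> real" and A b
  proof -
    have "\<bar>sum h A\<bar> \<le> card A * b"
      using that(3) by (intro order_trans[OF sum_abs] sum_bounded_above) auto
    then show ?thesis using that(1,2) by (simp add: abs_divide divide_le_eq card_gt_0_iff mult.commute)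
  qed
  have g2B: "g n x \<le> 2 * B" for n x
  proof -
    have "\<bar>c n\<bar> \<le> B"
      unfolding c by (rule avg) (use fin B in auto)
    moreover have "\<bar>(\<Sum>j<card (\<Gamma> n). f ((T ^^ j) x)) / card (\<Gamma> n)\<bar> \<le> B"
      using avg[of "{..<card (\<Gamma> n)}" "\<lambda>j. f ((T ^^ j) x)" B] B(2) pos[of n] by auto
    ultimately show ?thesis unfolding g_def by linarith
  qed
  have "uniformly_continuous_on UNIV f"
    using f compact by (rule compact_uniformly_continuous)
  then obtain d where d: "d > 0" "\<And>x y. dist x y < d \<Longrightarrow> \<bar>f x - f y\<bar> < \<epsilon> / 2"
    unfolding uniformly_continuous_on_def dist_real_def using \<open>\<epsilon> > 0\<close>
    by (metis UNIV_I dist_commute half_gt_zero)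
  have "\<delta> > 0" using B \<open>\<epsilon> > 0\<close> by (simp add: \<delta>_def)
  \<comment> \<open>From here \<open>n\<close> is so large that, for every later orbit, all but a
    proportion \<open>\<delta>\<close> of its points shadow \<open>\<Gamma> n\<close> within less
    than \<open>d\<close>.\<close>
  from convergent_prod_tail_ge[OF \<kappa>(1) \<kappa>1 \<kappa>(2,3) this] summable_tail_less[OF \<gamma> d(1)]
  have "\<forall>\<^sub>F n in sequentially. integral\<^sup>L \<mu> (g n) \<le> \<epsilon>"
  proof eventually_elim
    case (elim n)
    have "integral\<^sup>L (orbit_measure (\<Gamma> m)) (g n) \<le> \<epsilon>" if "n \<le> m" for m
    proof -
      obtain D where D: "D \<subseteq> \<Gamma> m" "(\<Prod>k=n..<m. \<kappa> k) \<le> card D / card (\<Gamma> m)"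
        and close: "\<And>y. y \<in> D \<Longrightarrow>
          \<exists>z\<in>\<Gamma> n. \<forall>j<card (\<Gamma> n). dist ((T ^^ j) y) ((T ^^ j) z) \<le> (\<Sum>k=n..<m. \<gamma> k)"
        using good_approximation_chain[of T \<gamma> \<kappa> \<Gamma>, OF approx fin inc \<kappa>(1) \<open>n \<le> m\<close>] by blast
      have small: "g n y \<le> \<epsilon> / 2" if "y \<in> D" for y
      proof -
        obtain z where z: "z \<in> \<Gamma> n"
          "\<And>j. j < card (\<Gamma> n) \<Longrightarrow> dist ((T ^^ j) y) ((T ^^ j) z) \<le> (\<Sum>k=n..<m. \<gamma> k)"
          using close[OF \<open>y \<in> D\<close>] by blast
        have "\<bar>f ((T ^^ j) y) - f ((T ^^ j) z)\<bar> \<le> \<epsilon> / 2" if "j < card (\<Gamma> n)" for j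
        proof -
          have "(\<Sum>k=n..<m. \<gamma> k) < d" using elim(2) \<open>n \<le> m\<close> by blast
          with z(2)[OF that] have "dist ((T ^^ j) y) ((T ^^ j) z) < d" by (rule le_less_trans)
          then show ?thesis by (rule less_imp_le[OF d(2)])
        qed
        then have "\<bar>(\<Sum>j<card (\<Gamma> n). f ((T ^^ j) y) - f ((T ^^ j) z)) / card {..<card (\<Gamma> n)}\<bar> \<le> \<epsilon> / 2"
          by (intro avg) (use pos[of n] in auto)
        \<comment> \<open>The shadowed point \<open>z\<close> lies on \<open>\<Gamma> n\<close> and
          the window is a full period, so its Birkhoff average is exactly
          \<open>c n\<close>.\<close>
        moreover have "c n = (\<Sum>j<card (\<Gamma> n). f ((T ^^ j) z)) / card (\<Gamma> n)"
          unfolding c periodic_orbit_sum[OF orbit z(1)] ..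
        ultimately show ?thesis
          unfolding g_def by (simp add: sum_subtractf diff_divide_distrib)
      qed
      have "1 - \<delta> \<le> card D / card (\<Gamma> m)"
        using elim(1) that D(2) order_trans by blast
      then have "integral\<^sup>L (orbit_measure (\<Gamma> m)) (g n) \<le> \<epsilon> / 2 + 2 * B * \<delta>"
        by (intro integral_orbit_measure_le[OF fin gm D(1)]) (use small g2B B \<open>\<epsilon> > 0\<close> in auto)
      also have "\<dots> = \<epsilon>" using B(1) by (simp add: \<delta>_def)
      finally show ?thesis .
    qed
    \<comment> \<open>Only now does \<open>m\<close> tend to infinity, with \<open>n\<close> and the
      test function \<open>g n\<close> fixed.\<close>
    then have "\<forall>\<^sub>F m in sequentially. integral\<^sup>L (orbit_measure (\<Gamma> m)) (g n) \<le> \<epsilon>"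
      unfolding eventually_sequentially by blast
    moreover have "(\<lambda>m. integral\<^sup>L (orbit_measure (\<Gamma> m)) (g n)) \<longlonglongrightarrow> integral\<^sup>L \<mu> (g n)"
      using lim gcont unfolding weak_star_limit_def by blast
    ultimately show ?case
      by (intro tendsto_upperbound) auto
  qed
  then show ?thesis unfolding g_def c_def .
qed

section \<open>Invariance of the limit measure\<close>

text \<open>Along each orbit \<open>f\<close> and its composition with \<open>T\<close> have equal
  means. Both are continuous test functions, so their integrals against \<open>\<mu>\<close> are
  limits of the same sequence.\<close>

lemma weak_star_limit_orbit_measures_invariant:
  fixes T :: "'a::metric_space \<Rightarrow> 'a"
  assumes T: "continuous_on UNIV T" and orbit: "\<And>n. periodic_orbit T (\<Gamma> n)"
    and "weak_star_limit (\<lambda>n. orbit_measure (\<Gamma> n)) \<mu>"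
    and "prob_space \<mu>" and sets: "sets \<mu> = sets borel"
  shows "distr \<mu> borel T = \<mu>"
proof -
  interpret prob_space \<mu> by fact
  note fin = periodic_orbit_finite_nonempty[OF orbit]
  have Tm: "T \<in> \<mu> \<rightarrow>\<^sub>M borel"
    using borel_measurable_continuous_onI[OF T] by (simp add: measurable_cong_sets[OF sets refl])
  show ?thesis
  proof (rule finite_measure_eqI_continuous)
    fix f :: "'a \<Rightarrow> real" assume f: "continuous_on UNIV f"
    then have fT: "continuous_on UNIV (\<lambda>x. f (T x))"
      by (rule continuous_on_compose2[OF _ T]) auto
    have "integral\<^sup>L (orbit_measure (\<Gamma> n)) (\<lambda>x. f (T x)) = integral\<^sup>L (orbit_measure (\<Gamma> n)) f" for n
      using f fT
      by (simp add: integral_orbit_measure[OF fin] borel_measurable_continuous_onI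
          periodic_orbit_sum_shift[OF orbit])
    then have eq: "(\<lambda>n. integral\<^sup>L (orbit_measure (\<Gamma> n)) (\<lambda>x. f (T x)))
        = (\<lambda>n. integral\<^sup>L (orbit_measure (\<Gamma> n)) f)"
      by (rule ext)
    have conv: "(\<lambda>n. integral\<^sup>L (orbit_measure (\<Gamma> n)) h) \<longlonglongrightarrow> integral\<^sup>L \<mu> h"
      if "continuous_on UNIV h" for h :: "'a \<Rightarrow> real"
      using assms(3) that unfolding weak_star_limit_def by blast
    have "integral\<^sup>L \<mu> (\<lambda>x. f (T x)) = integral\<^sup>L \<mu> f"
      by (rule LIMSEQ_unique[OF conv[OF fT, unfolded eq] conv[OF f]])
    then show "integral\<^sup>L (distr \<mu> borel T) f = integral\<^sup>L \<mu> f"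
      by (simp add: integral_distr[OF Tm borel_measurable_continuous_onI[OF f]])
  qed (use sets Tm finite_measure_distr finite_measure_axioms in auto)
qed

lemma integral_funpow_invariant:
  fixes h :: "'a::topological_space \<Rightarrow> real"
  assumes "distr \<mu> borel T = \<mu>" "T \<in> borel \<rightarrow>\<^sub>M borel" "sets \<mu> = sets borel"
    and "h \<in> borel_measurable borel"
  shows "(\<integral>x. h ((T ^^ j) x) \<partial>\<mu>) = integral\<^sup>L \<mu> h"
proof (induction j)
  case (Suc j)
  have Tm: "T \<in> \<mu> \<rightarrow>\<^sub>M borel"
    using assms(2) by (simp add: measurable_cong_sets[OF assms(3) refl])
  have "(\<lambda>x. h ((T ^^ j) x)) \<in> borel_measurable borel"
    by (rule measurable_compose[OF measurable_compose_n[OF assms(2)] assms(4)])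
  then have "(\<integral>x. h ((T ^^ j) x) \<partial>distr \<mu> borel T) = (\<integral>x. h ((T ^^ j) (T x)) \<partial>\<mu>)"
    by (rule integral_distr[OF Tm])
  then show ?case
    using Suc assms(1) by (simp add: funpow_swap1)
qed simp

section \<open>Ergodicity\<close>

theorem corollary7p4:
  fixes T :: "'a::metric_space \<Rightarrow> 'a" and \<mu> :: "'a measure"
  assumes "compact (UNIV :: 'a set)"
    and "continuous_on UNIV T"
    and "royal T \<mu>"
  shows "ergodic T \<mu>"
proof -
  obtain \<Gamma> where prob: "prob_space \<mu>" and sets: "sets \<mu> = sets borel"
    and GIKN: "GIKN_sequence T \<Gamma>" and lim: "weak_star_limit (\<lambda>n. orbit_measure (\<Gamma> n)) \<mu>"
    using assms(3) unfolding royal_def by blast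
  interpret prob_space \<mu> by fact
  have orbit: "periodic_orbit T (\<Gamma> n)" for n
    using GIKN unfolding GIKN_sequence_def by blast
  have pos: "card (\<Gamma> n) > 0" for n
    using periodic_orbit_finite_nonempty[OF orbit[of n]] by (simp add: card_gt_0_iff)
  have Tm: "T \<in> borel \<rightarrow>\<^sub>M borel"
    using assms(2) by (rule borel_measurable_continuous_onI)
  have inv: "distr \<mu> borel T = \<mu>"
    by (rule weak_star_limit_orbit_measures_invariant[OF assms(2) orbit lim prob sets])
  have meas [simp]: "h \<in> borel_measurable \<mu> \<longleftrightarrow> h \<in> borel_measurable borel" for h :: "'a \<Rightarrow> real"
    by (simp add: measurable_cong_sets[OF sets refl])
  have "measure \<mu> A = 0 \<or> measure \<mu> A = 1" if A: "A \<in> sets borel" "T -` A = A" for A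
  proof -
    have As: "A \<in> sets \<mu>" using A sets by simp
    have TA: "indicator A ((T ^^ j) x) = (indicator A x :: real)" for j x
    proof (induction j)
      case (Suc j)
      have "T y \<in> A \<longleftrightarrow> y \<in> A" for y using A(2) by auto
      with Suc show ?case by (simp add: indicator_def)
    qed simp
    \<comment> \<open>An invariant set is uncorrelated with every continuous function.\<close>
    have split: "(\<integral>x. indicator A x * f x \<partial>\<mu>) = measure \<mu> A * integral\<^sup>L \<mu> f"
      if f: "continuous_on UNIV f" for f :: "'a \<Rightarrow> real"
    proof -
      define c where "c n = integral\<^sup>L (orbit_measure (\<Gamma> n)) f" for n
      define a where "a n x = (\<Sum>j<card (\<Gamma> n). f ((T ^^ j) x)) / card (\<Gamma> n)" for n x
      have int: "integrable \<mu> h" if "continuous_on UNIV h" for h :: "'a \<Rightarrow> real"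
      proof -
        have "bounded (range h)"
          by (rule compact_imp_bounded[OF compact_continuous_image[OF that assms(1)]])
        then obtain B where "\<And>x. norm (h x) \<le> B"
          unfolding bounded_iff by auto
        then show ?thesis
          by (intro integrable_const_bound[of _ B]) (use that borel_measurable_continuous_onI in auto)
      qed
      have intA: "integrable \<mu> (\<lambda>x. indicator A x * h x)" if "continuous_on UNIV h" for h :: "'a \<Rightarrow> real"
        using integrable_mult_indicator[OF As int[OF that]] by simp
      have fT: "continuous_on UNIV (\<lambda>x. f ((T ^^ j) x))" for j
        by (intro continuous_on_compose2[OF f] continuous_on_funpow assms(2)) auto
      have acont: "continuous_on UNIV (a n)" for n
        unfolding a_def by (intro continuous_intros fT) (use pos in auto)
      \<comment> \<open>As \<open>A\<close> is invariant, \<open>indicator A\<close> can be composed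
        with any iterate for free. Invariance of \<open>\<mu>\<close> then makes all summands equal,
        so averaging leaves the integral over \<open>A\<close> unchanged.\<close>
      have Aa: "(\<integral>x. indicator A x * a n x \<partial>\<mu>) = (\<integral>x. indicator A x * f x \<partial>\<mu>)" for n
      proof -
        have m: "(\<lambda>x. indicator A x * f x) \<in> borel_measurable borel"
          using A(1) borel_measurable_continuous_onI[OF f] by measurable
        have "(\<integral>x. indicator A x * a n x \<partial>\<mu>)
            = (\<integral>x. (\<Sum>j<card (\<Gamma> n). indicator A x * f ((T ^^ j) x)) / card (\<Gamma> n) \<partial>\<mu>)"
          by (simp add: a_def sum_distrib_left)
        also have "\<dots> = (\<Sum>j<card (\<Gamma> n). \<integral>x. indicator A x * f ((T ^^ j) x) \<partial>\<mu>) / card (\<Gamma> n)"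
          by (subst integral_divide_zero, subst Bochner_Integration.integral_sum) (rule intA[OF fT], rule refl)
        also have "\<dots> = (\<Sum>j<card (\<Gamma> n). \<integral>x. indicator A x * f x \<partial>\<mu>) / card (\<Gamma> n)"
          using integral_funpow_invariant[OF inv Tm sets m] by (simp add: TA)
        also have "\<dots> = (\<integral>x. indicator A x * f x \<partial>\<mu>)"
          using pos[of n] by simp
        finally show ?thesis .
      qed
      \<comment> \<open>\<open>f\<close> is replaced by its average \<open>a n\<close>, after which
        restricting to \<open>A\<close> can only decrease the integral of the absolute
        deviation.\<close>
      have bound: "\<bar>(\<integral>x. indicator A x * f x \<partial>\<mu>) - measure \<mu> A * c n\<bar> \<le> (\<integral>x. \<bar>a n x - c n\<bar> \<partial>\<mu>)" for n
      proof -
        have cont: "continuous_on UNIV (\<lambda>x. a n x - c n)"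
          by (intro continuous_intros acont)
        have "(\<integral>x. indicator A x * f x \<partial>\<mu>) - measure \<mu> A * c n
            = (\<integral>x. indicator A x * (a n x - c n) \<partial>\<mu>)"
          using intA[OF acont[of n]] intA[of "\<lambda>_. c n"] As sets.sets_into_space[OF As]
          by (simp add: right_diff_distrib Aa Int_absorb2)
        also have "\<bar>\<dots>\<bar> \<le> (\<integral>x. \<bar>indicator A x * (a n x - c n)\<bar> \<partial>\<mu>)"
          by (rule integral_abs_bound)
        also have "\<dots> \<le> (\<integral>x. \<bar>a n x - c n\<bar> \<partial>\<mu>)"
          using intA[OF cont] int[OF cont]
          by (intro integral_mono) (auto simp: indicator_def)
        finally show ?thesis .
      qed
      have "(\<lambda>n. (\<integral>x. indicator A x * f x \<partial>\<mu>) - measure \<mu> A * c n) \<longlonglongrightarrow> 0"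
      proof (rule tendstoI)
        fix e :: real assume "e > 0"
        then have "\<forall>\<^sub>F n in sequentially. (\<integral>x. \<bar>a n x - c n\<bar> \<partial>\<mu>) \<le> e / 2"
          using GIKN_birkhoff_average_L1[OF assms(1,2) GIKN lim f, of "e / 2"] by (simp add: a_def c_def)
        then show "\<forall>\<^sub>F n in sequentially.
            dist ((\<integral>x. indicator A x * f x \<partial>\<mu>) - measure \<mu> A * c n) 0 < e"
        proof eventually_elim
          case (elim n)
          then show ?case using bound[of n] \<open>e > 0\<close> by (simp add: dist_real_def)
        qed
      qed
      \<comment> \<open>The same sequence has the limit 0 and, since \<open>c\<close> converges,
        also the difference in \<open>split\<close>; the two agree.\<close>
      moreover have "c \<longlonglongrightarrow> integral\<^sup>L \<mu> f"
        using lim f unfolding weak_star_limit_def c_def by blast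
      then have "(\<lambda>n. (\<integral>x. indicator A x * f x \<partial>\<mu>) - measure \<mu> A * c n)
          \<longlonglongrightarrow> (\<integral>x. indicator A x * f x \<partial>\<mu>) - measure \<mu> A * integral\<^sup>L \<mu> f"
        by (intro tendsto_intros)
      ultimately show ?thesis using LIMSEQ_unique by fastforce
    qed
    \<comment> \<open>\<open>split\<close> compares integrals against \<open>\<mu>\<close>
      restricted to \<open>A\<close> and \<open>\<mu>\<close> scaled by
      \<open>measure \<mu> A\<close>. These measures therefore coincide, and evaluating both at
      \<open>A\<close> shows that \<open>measure \<mu> A\<close> equals its own square.\<close>
    have "density \<mu> (indicator A) = density \<mu> (\<lambda>_. measure \<mu> A)"
    proof (rule finite_measure_eqI_continuous)
      have [measurable]: "A \<in> sets borel" by (rule A(1))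
      show "finite_measure (density \<mu> (indicator A))"
        using As by (intro finite_measureI) (simp add: emeasure_density emeasure_eq_measure)
      show "finite_measure (density \<mu> (\<lambda>_. measure \<mu> A))"
        by (intro finite_measureI) (simp add: emeasure_density emeasure_space_1)
      fix f :: "'a \<Rightarrow> real" assume f: "continuous_on UNIV f"
      have fm: "f \<in> borel_measurable \<mu>" using borel_measurable_continuous_onI[OF f] by simp
      have "integral\<^sup>L (density \<mu> (\<lambda>x. ennreal (indicator A x))) f = (\<integral>x. indicator A x *\<^sub>R f x \<partial>\<mu>)"
        by (rule integral_density) (use fm in auto)
      moreover have "integral\<^sup>L (density \<mu> (\<lambda>_. measure \<mu> A)) f = (\<integral>x. measure \<mu> A *\<^sub>R f x \<partial>\<mu>)"
        by (rule integral_density) (use fm in auto)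
      ultimately show "integral\<^sup>L (density \<mu> (indicator A)) f = integral\<^sup>L (density \<mu> (\<lambda>_. measure \<mu> A)) f"
        using split[OF f] by (simp add: ennreal_indicator)
    qed (use sets in auto)
    then have "emeasure (density \<mu> (indicator A)) A = emeasure (density \<mu> (\<lambda>_. measure \<mu> A)) A"
      by simp
    then have "measure \<mu> A = measure \<mu> A * measure \<mu> A"
      using As by (simp add: emeasure_restricted emeasure_density_const emeasure_eq_measure flip: ennreal_mult)
    then show ?thesis by simp
  qed
  then show ?thesis
    unfolding ergodic_def using prob sets Tm inv by blast
qed

end
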